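(* Let $D$ be a digraph on $n$ vertices which either has diameter $2$ or is a bipartite digraph of diameter $3$. Then $c(D)\leq\sqrt{2n}$.
   Context: A digraph has diameter $2$ if for any two vertices $u,v$ there is a directed path from $u$ to $v$ of length at most $2$; a bipartite digraph (vertex set partitioned into two parts with every arc joining the two parts) has diameter $3$ if for any two vertices $u,v$ there is a directed path from $u$ to $v$ of length at most $3$. Cops and Robbers on a digraph $D$: first each of $k$ cops chooses an initial vertex, then the robber chooses one. Then the players alternate, starting with the cops: in a cops' turn every cop either stays or moves from its vertex $x$ to an out-neighbour $y$ (along an arc $x\to y$), and in the robber's turn the robber stays or moves along an arc to an out-neighbour. Several cops may occupy the same vertex; full information. The cops win if, whatever the robber does, after some cops' move some cop occupies the robber's vertex. $c(D)$ is the least $k$ for which the cops win. *)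

theory Defs
  imports Complex_Main "Graph_Theory.Graph_Theory"
begin

text \<open>Following the usual convention for diameter-two graphs, the bound on the
  directed distances is an upper bound only; it need not be attained.\<close>

definition has_diameter :: "('a, 'b) pre_digraph \<Rightarrow> nat \<Rightarrow> bool" where
  "has_diameter D d \<longleftrightarrow>
    (\<forall>u\<in>verts D. \<forall>v\<in>verts D. \<exists>p. pre_digraph.apath D u p v \<and> length p \<le> d)"

definition bipartite_digraph :: "('a, 'b) pre_digraph \<Rightarrow> bool" where
  "bipartite_digraph D \<longleftrightarrow>
    (\<exists>A B. A \<union> B = verts D \<and> A \<inter> B = {} \<and>
      (\<forall>e\<in>arcs D. tail D e \<in> A \<and> head D e \<in> B \<or> tail D e \<in> B \<and> head D e \<in> A))"

definition legal_move :: "('a, 'b) pre_digraph \<Rightarrow> 'a \<Rightarrow> 'a \<Rightarrow> bool" where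
  "legal_move D x y \<longleftrightarrow> y = x \<or> x \<rightarrow>\<^bsub>D\<^esub> y"

text \<open>\<open>r t\<close> is the robber's vertex after \<open>t\<close> robber moves, \<open>r 0\<close> being the initial choice.
  Since staying is always legal, it suffices to consider infinite trajectories.\<close>

definition robber_trajectory :: "('a, 'b) pre_digraph \<Rightarrow> (nat \<Rightarrow> 'a) \<Rightarrow> bool" where
  "robber_trajectory D r \<longleftrightarrow> r 0 \<in> verts D \<and> (\<forall>t. legal_move D (r t) (r (Suc t)))"

text \<open>A strategy of the cops maps the list of all robber positions seen so far, in
  chronological order, to the list of the cops' vertices. Their own earlier positions are
  determined by the strategy and that list, so this is a general history-dependent strategy.
  The empty list yields the initial placement, chosen before the robber's.\<close>

definition cops_position :: "('a list \<Rightarrow> 'a list) \<Rightarrow> (nat \<Rightarrow> 'a) \<Rightarrow> nat \<Rightarrow> 'a list" where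
  "cops_position s r t = s (map r [0..<t])"

definition cop_strategy :: "('a, 'b) pre_digraph \<Rightarrow> nat \<Rightarrow> ('a list \<Rightarrow> 'a list) \<Rightarrow> bool" where
  "cop_strategy D k s \<longleftrightarrow>
    length (s []) = k \<and> set (s []) \<subseteq> verts D \<and>
    (\<forall>r. robber_trajectory D r \<longrightarrow>
      (\<forall>t. list_all2 (legal_move D) (cops_position s r t) (cops_position s r (Suc t))))"

text \<open>The robber stands on \<open>r t\<close> right after the cops' move number \<open>Suc t\<close>.\<close>

definition cops_win :: "('a, 'b) pre_digraph \<Rightarrow> nat \<Rightarrow> bool" where
  "cops_win D k \<longleftrightarrow>
    (\<exists>s. cop_strategy D k s \<and>
      (\<forall>r. robber_trajectory D r \<longrightarrow> (\<exists>t. r t \<in> set (cops_position s r (Suc t)))))"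

definition cop_number :: "('a, 'b) pre_digraph \<Rightarrow> nat" where
  "cop_number D = (LEAST k. cops_win D k)"

lemma cops_win_card_verts:
  assumes "finite (verts D)"
  shows "cops_win D (card (verts D))"
proof -
  obtain xs where xs: "set xs = verts D" "length xs = card (verts D)"
    using assms finite_distinct_list distinct_card by metis
  have "cop_strategy D (card (verts D)) (\<lambda>_. xs)"
    using xs by (auto simp: cop_strategy_def cops_position_def legal_move_def
        intro: list_all2_refl)
  then show ?thesis
    using xs by (auto simp: cops_win_def cops_position_def robber_trajectory_def)
qed

lemma cops_win_cop_number:
  "finite (verts D) \<Longrightarrow> cops_win D (cop_number D)"
  unfolding cop_number_def by (rule LeastI) (rule cops_win_card_verts)

end

theory Submission
  imports Defs "HOL-Library.Discrete_Functions"
begin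

text \<open>Let \<open>m\<close> be the integer part of \<open>sqrt (2 * n)\<close>. Place stationary cops greedily: as long as
  \<open>s < m\<close> cops have been placed and some closed out-neighbourhood contains more than \<open>m - s\<close>
  vertices not yet dominated, put the next cop there. If this went on for \<open>m\<close> rounds, at least
  \<open>(m + 1) + m + \<dots> + 2 = m * (m + 3) / 2 > n\<close> vertices would be dominated. So it stops with
  \<open>s < m\<close>, and wherever the robber stands there are at most \<open>m - s\<close> undominated vertices where
  he can be after his next move; the remaining \<open>m - s\<close> cops are assigned to these.

  In diameter 2, each remaining cop can move to within distance one of its assigned vertex, so
  the robber is caught at the second move. In the bipartite case one remaining cop is a chaser
  and the others are guards, all starting on one vertex. The chaser walks towards the robber as
  long as he stays put, so he must move; hence at some point he is on the side opposite to the
  guards. His out-neighbours are then on the guards' side, so within distance two of them, and the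
  guards can cover all his exits while the chaser comes to capture him.\<close>

section \<open>Winning positions\<close>

inductive cops_win_from :: "('a, 'b) pre_digraph \<Rightarrow> 'a list \<Rightarrow> 'a \<Rightarrow> bool" for D where
  capture: "list_all2 (legal_move D) cs cs' \<Longrightarrow> v \<in> set cs' \<Longrightarrow> cops_win_from D cs v"
| move: "list_all2 (legal_move D) cs cs' \<Longrightarrow>
    (\<And>v'. legal_move D v v' \<Longrightarrow> cops_win_from D cs' v') \<Longrightarrow> cops_win_from D cs v"

definition winning_strategy ::
    "('a, 'b) pre_digraph \<Rightarrow> 'a list \<Rightarrow> 'a set \<Rightarrow> ('a list \<Rightarrow> 'a list) \<Rightarrow> bool" where
  "winning_strategy D cs V s \<longleftrightarrow> s [] = cs \<and>
    (\<forall>r. r 0 \<in> V \<longrightarrow> (\<forall>t. legal_move D (r t) (r (Suc t))) \<longrightarrow>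
      (\<forall>t. list_all2 (legal_move D) (cops_position s r t) (cops_position s r (Suc t))) \<and>
      (\<exists>t. r t \<in> set (cops_position s r (Suc t))))"

lemma legal_move_refl [simp]: "legal_move D x x"
  by (simp add: legal_move_def)

lemma list_all2_legal_move_refl [simp]: "list_all2 (legal_move D) cs cs"
  by (simp add: list_all2_refl)

lemma cops_position_0 [simp]: "cops_position s r 0 = s []"
  by (simp add: cops_position_def)

lemma cops_position_Suc:
  "cops_position s r (Suc t) = cops_position (\<lambda>h. s (r 0 # h)) (\<lambda>t. r (Suc t)) t"
  unfolding cops_position_def map_upt_Suc ..

lemma winning_strategy_capture:
  assumes "list_all2 (legal_move D) cs cs'" "v \<in> set cs'"
  shows "winning_strategy D cs {v} (case_list cs (\<lambda>_ _. cs'))"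
proof -
  have "cops_position (case_list cs (\<lambda>_ _. cs')) r (Suc t) = cs'" for r t
    unfolding cops_position_Suc by (simp add: cops_position_def)
  then have "list_all2 (legal_move D) (cops_position (case_list cs (\<lambda>_ _. cs')) r t)
      (cops_position (case_list cs (\<lambda>_ _. cs')) r (Suc t))"
    and "r 0 = v \<Longrightarrow> r 0 \<in> set (cops_position (case_list cs (\<lambda>_ _. cs')) r (Suc 0))" for r t
    using assms by (cases t; simp)+
  then show ?thesis
    unfolding winning_strategy_def by auto
qed

lemma winning_strategy_move:
  assumes reply: "list_all2 (legal_move D) cs cs'"
    and wins: "winning_strategy D cs' {v'. legal_move D v v'} s"
  shows "winning_strategy D cs {v} (case_list cs (\<lambda>_. s))"
  unfolding winning_strategy_def
proof (intro conjI allI impI)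
  fix r :: "nat \<Rightarrow> 'a"
  assume r: "r 0 \<in> {v}" "\<forall>t. legal_move D (r t) (r (Suc t))"
  let ?p = "cops_position s (\<lambda>t. r (Suc t))"
  have shift: "cops_position (case_list cs (\<lambda>_. s)) r (Suc t) = ?p t" for t
    by (simp add: cops_position_Suc)
  have after: "list_all2 (legal_move D) (?p t) (?p (Suc t))"
    "\<exists>t. r (Suc t) \<in> set (?p (Suc t))" for t
    using wins r unfolding winning_strategy_def by auto
  have "?p 0 = cs'"
    using wins by (simp add: winning_strategy_def)
  then show "list_all2 (legal_move D) (cops_position (case_list cs (\<lambda>_. s)) r t)
      (cops_position (case_list cs (\<lambda>_. s)) r (Suc t))" for t
    using reply after(1) by (cases t) (simp_all add: shift)
  show "\<exists>t. r t \<in> set (cops_position (case_list cs (\<lambda>_. s)) r (Suc t))"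
    using after(2) unfolding shift by blast
qed simp

lemma winning_strategy_union:
  assumes "\<And>v. v \<in> V \<Longrightarrow> \<exists>s. winning_strategy D cs {v} s"
  shows "\<exists>s. winning_strategy D cs V s"
proof -
  obtain \<sigma> where \<sigma>: "\<And>v. v \<in> V \<Longrightarrow> winning_strategy D cs {v} (\<sigma> v)"
    using assms by metis
  define s where "s h = (case h of [] \<Rightarrow> cs | v # _ \<Rightarrow> \<sigma> v h)" for h
  have "(\<forall>t. list_all2 (legal_move D) (cops_position s r t) (cops_position s r (Suc t))) \<and>
      (\<exists>t. r t \<in> set (cops_position s r (Suc t)))"
    if r: "r 0 \<in> V" "\<forall>t. legal_move D (r t) (r (Suc t))" for r
  proof -
    have win: "winning_strategy D cs {r 0} (\<sigma> (r 0))"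
      using r(1) by (rule \<sigma>)
    then have "\<sigma> (r 0) [] = cs"
      unfolding winning_strategy_def by blast
    then have "cops_position s r t = cops_position (\<sigma> (r 0)) r t" for t
      by (cases t) (simp_all add: s_def cops_position_Suc)
    with win r(2) show ?thesis
      unfolding winning_strategy_def by simp
  qed
  then have "winning_strategy D cs V s"
    unfolding winning_strategy_def by (simp add: s_def)
  then show ?thesis by blast
qed

lemma cops_win_from_imp_winning_strategy:
  "cops_win_from D cs v \<Longrightarrow> \<exists>s. winning_strategy D cs {v} s"
proof (induction rule: cops_win_from.induct)
  case (capture cs cs' v)
  then show ?case by (intro exI) (rule winning_strategy_capture)
next
  case (move cs cs' v)
  have "\<exists>s. winning_strategy D cs' {v'. legal_move D v v'} s"
    by (rule winning_strategy_union) (simp add: move.IH)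
  then obtain s where "winning_strategy D cs' {v'. legal_move D v v'} s" ..
  with move.hyps(1) show ?case by (intro exI) (rule winning_strategy_move)
qed

lemma cops_win_if_cops_win_from:
  assumes "set cs \<subseteq> verts D" "\<And>v. v \<in> verts D \<Longrightarrow> cops_win_from D cs v"
  shows "cops_win D (length cs)"
proof -
  obtain s where "winning_strategy D cs (verts D) s"
    using winning_strategy_union cops_win_from_imp_winning_strategy assms(2) by metis
  with assms(1) show ?thesis
    unfolding winning_strategy_def cops_win_def cop_strategy_def robber_trajectory_def by blast
qed

section \<open>Domination\<close>

definition closed_out_nbhd :: "('a, 'b) pre_digraph \<Rightarrow> 'a \<Rightarrow> 'a set" where
  "closed_out_nbhd D v = {u. legal_move D v u}"

definition dominated :: "('a, 'b) pre_digraph \<Rightarrow> 'a set \<Rightarrow> 'a set" where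
  "dominated D S = (\<Union>x\<in>S. closed_out_nbhd D x)"

definition nearly_dominating :: "('a, 'b) pre_digraph \<Rightarrow> nat \<Rightarrow> 'a list \<Rightarrow> bool" where
  "nearly_dominating D m S \<longleftrightarrow> set S \<subseteq> verts D \<and> length S < m \<and>
    (\<forall>v\<in>verts D. card (closed_out_nbhd D v - dominated D (set S)) \<le> m - length S)"

lemma mem_closed_out_nbhd [simp]: "u \<in> closed_out_nbhd D v \<longleftrightarrow> legal_move D v u"
  by (simp add: closed_out_nbhd_def)

lemma dominated_Un [simp]: "dominated D (S \<union> T) = dominated D S \<union> dominated D T"
  by (simp add: dominated_def)

lemma dominated_insert [simp]:
  "dominated D (insert x S) = closed_out_nbhd D x \<union> dominated D S"
  by (simp add: dominated_def)

lemma (in wf_digraph) closed_out_nbhd_subset_verts: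
  "v \<in> verts G \<Longrightarrow> closed_out_nbhd G v \<subseteq> verts G"
  by (auto simp: legal_move_def dest: adj_in_verts)

lemma (in fin_digraph) finite_closed_out_nbhd:
  "v \<in> verts G \<Longrightarrow> finite (closed_out_nbhd G v)"
  using closed_out_nbhd_subset_verts finite_verts by (rule finite_subset)

lemma greedy_cover:
  fixes N :: "'a \<Rightarrow> 'b set" and f :: "nat \<Rightarrow> nat"
  assumes "finite W" and N: "\<And>v. v \<in> V \<Longrightarrow> N v \<subseteq> W" and "card W < (\<Sum>i<m. f i)"
  obtains S where "set S \<subseteq> V" "length S < m"
    "\<And>v. v \<in> V \<Longrightarrow> card (N v - \<Union>(N ` set S)) < f (length S)"
proof (rule ccontr)
  assume "\<not> thesis"
  with that have gain: "\<exists>v\<in>V. f (length S) \<le> card (N v - \<Union>(N ` set S))"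
    if "set S \<subseteq> V" "length S < m" for S
    using that by (metis not_less)
  have "\<exists>S. set S \<subseteq> V \<and> length S = k \<and> (\<Sum>i<k. f i) \<le> card (\<Union>(N ` set S))"
    if "k \<le> m" for k
    using that
  proof (induction k)
    case (Suc k)
    then obtain S where S: "set S \<subseteq> V" "length S = k" "(\<Sum>i<k. f i) \<le> card (\<Union>(N ` set S))"
      by auto
    obtain v where v: "v \<in> V" "f k \<le> card (N v - \<Union>(N ` set S))"
      using gain[OF S(1)] S(2) Suc.prems by auto
    have "\<Union>(N ` set S) \<subseteq> W" "N v \<subseteq> W"
      using N S(1) v(1) by blast+
    then have "finite (\<Union>(N ` set S))" "finite (N v - \<Union>(N ` set S))"
      using \<open>finite W\<close> by (auto intro: finite_subset)
    moreover have "\<Union>(N ` set (v # S)) = \<Union>(N ` set S) \<union> (N v - \<Union>(N ` set S))"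
      by auto
    ultimately have "card (\<Union>(N ` set (v # S))) =
        card (\<Union>(N ` set S)) + card (N v - \<Union>(N ` set S))"
      by (simp only: card_Un_disjoint Diff_disjoint)
    with S v show ?case by (intro exI[of _ "v # S"]) simp
  qed simp
  then obtain S where "set S \<subseteq> V" "(\<Sum>i<m. f i) \<le> card (\<Union>(N ` set S))"
    by blast
  moreover have "card (\<Union>(N ` set S)) \<le> card W"
    using N \<open>set S \<subseteq> V\<close> \<open>finite W\<close> by (intro card_mono) blast+
  ultimately show False
    using assms(3) by simp
qed

lemma double_sum_descending: "2 * (\<Sum>i<m. m + 1 - i) = m * (m + 3)" for m :: nat
proof -
  have "(\<Sum>i<m. m + 1 - i) = (\<Sum>i<m. m - Suc i + 2)"
    by (intro sum.cong) auto
  also have "\<dots> = (\<Sum>i<m. i + 2)"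
    by (rule sum.nat_diff_reindex)
  also have "2 * \<dots> = m * (m + 3)"
    by (induction m) (auto simp: algebra_simps)
  finally show ?thesis .
qed

lemma (in fin_digraph) exists_nearly_dominating:
  assumes "2 * card (verts G) < m * (m + 3)"
  shows "\<exists>S. nearly_dominating G m S"
proof -
  have "card (verts G) < (\<Sum>i<m. m + 1 - i)"
    using assms double_sum_descending[of m] by simp
  then obtain S where "set S \<subseteq> verts G" "length S < m"
    "\<And>v. v \<in> verts G \<Longrightarrow>
      card (closed_out_nbhd G v - \<Union>(closed_out_nbhd G ` set S)) < m + 1 - length S"
    using greedy_cover[where W = "verts G" and N = "closed_out_nbhd G" and V = "verts G"]
      closed_out_nbhd_subset_verts finite_verts by auto
  then show ?thesis
    unfolding nearly_dominating_def dominated_def by fastforce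
qed

section \<open>Stationary cops, guards and chasers\<close>

lemma cops_win_from_dominated:
  assumes "v \<in> dominated D (set cs)"
  shows "cops_win_from D cs v"
proof -
  obtain c where "c \<in> set cs" "legal_move D c v"
    using assms by (auto simp: dominated_def)
  moreover from this obtain as bs where "cs = as @ c # bs"
    by (meson split_list)
  ultimately have "list_all2 (legal_move D) cs (as @ v # bs)"
    by (auto intro!: list_all2_appendI)
  then show ?thesis by (rule cops_win_from.capture) simp
qed

lemma guards_cover:
  assumes "finite U" "card U \<le> length gs"
    and "\<And>g. g \<in> set gs \<Longrightarrow> U \<subseteq> dominated D (closed_out_nbhd D g)"
  shows "\<exists>gs'. list_all2 (legal_move D) gs gs' \<and> U \<subseteq> dominated D (set gs')"
  using assms
proof (induction gs arbitrary: U)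
  case Nil
  then show ?case by simp
next
  case (Cons g gs)
  show ?case
  proof (cases "U = {}")
    case True
    then show ?thesis by (auto intro!: exI[of _ "g # gs"])
  next
    case False
    then obtain u where u: "u \<in> U" by auto
    then obtain w where w: "legal_move D g w" "legal_move D w u"
      using Cons.prems(3)[of g] by (auto simp: dominated_def)
    have "\<exists>gs'. list_all2 (legal_move D) gs gs' \<and> U - {u} \<subseteq> dominated D (set gs')"
    proof (rule Cons.IH)
      show "card (U - {u}) \<le> length gs"
        using Cons.prems(1,2) u by simp
    qed (use Cons.prems in auto)
    then obtain gs' where "list_all2 (legal_move D) gs gs'" "U - {u} \<subseteq> dominated D (set gs')"
      by blast
    with w show ?thesis by (intro exI[of _ "w # gs'"]) auto
  qed
qed

lemma replicate_guards_cover: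
  assumes "finite U" "card U \<le> k" "U \<subseteq> dominated D (closed_out_nbhd D a)"
  obtains cs where "list_all2 (legal_move D) (replicate k a @ S) cs"
    "U \<union> dominated D (set S) \<subseteq> dominated D (set cs)"
proof -
  have "\<exists>gs. list_all2 (legal_move D) (replicate k a) gs \<and> U \<subseteq> dominated D (set gs)"
    using assms by (intro guards_cover) auto
  then obtain gs where "list_all2 (legal_move D) (replicate k a) gs" "U \<subseteq> dominated D (set gs)"
    by blast
  then show thesis
    by (intro that[of "gs @ S"] list_all2_appendI) auto
qed

lemma (in wf_digraph) chaser_wins_or_robber_moves:
  assumes "c \<rightarrow>\<^sup>*\<^bsub>G\<^esub> v"
    and "\<And>c' u. c' \<in> verts G \<Longrightarrow> v \<rightarrow>\<^bsub>G\<^esub> u \<Longrightarrow> cops_win_from G (c' # cs) u"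
  shows "cops_win_from G (c # cs) v"
  using assms(1)
proof (induction rule: converse_reachable_induct)
  case base
  show ?case by (rule cops_win_from_dominated) simp
next
  case (step c c')
  have "list_all2 (legal_move G) (c # cs) (c' # cs)"
    using step.hyps(1) by (simp add: legal_move_def)
  then show ?case
  proof (rule cops_win_from.move)
    show "cops_win_from G (c' # cs) u" if "legal_move G v u" for u
      using that step.IH step.hyps assms(2) adj_in_verts by (auto simp: legal_move_def)
  qed
qed

lemma (in fin_digraph) cops_win_if_radius_2:
  assumes stationary: "nearly_dominating G m S" and base: "a \<in> verts G"
    and near: "verts G \<subseteq> dominated G (closed_out_nbhd G a)"
  shows "cops_win G m"
proof -
  let ?cs = "replicate (m - length S) a @ S"
  have "cops_win_from G ?cs v" if robber: "v \<in> verts G" for v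
  proof -
    let ?U = "closed_out_nbhd G v - dominated G (set S)"
    have "finite ?U" "card ?U \<le> m - length S" "?U \<subseteq> dominated G (closed_out_nbhd G a)"
      using stationary robber near finite_closed_out_nbhd closed_out_nbhd_subset_verts
      unfolding nearly_dominating_def by blast+
    then obtain cs where moved: "list_all2 (legal_move G) ?cs cs"
      and covered: "?U \<union> dominated G (set S) \<subseteq> dominated G (set cs)"
      by (rule replicate_guards_cover)
    from moved show ?thesis
    proof (rule cops_win_from.move)
      show "cops_win_from G cs u" if "legal_move G v u" for u
        using that covered by (intro cops_win_from_dominated) auto
    qed
  qed
  then have "cops_win G (length ?cs)"
    using stationary base
    by (intro cops_win_if_cops_win_from) (auto simp: nearly_dominating_def)
  with stationary show ?thesis by (simp add: nearly_dominating_def)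
qed

section \<open>Bipartite digraphs\<close>

definition bipartition_class :: "('a, 'b) pre_digraph \<Rightarrow> 'a set \<Rightarrow> bool" where
  "bipartition_class D A \<longleftrightarrow> (\<forall>x y. x \<rightarrow>\<^bsub>D\<^esub> y \<longrightarrow> (x \<in> A \<longleftrightarrow> y \<notin> A))"

lemma bipartite_digraph_imp_bipartition_class:
  assumes "bipartite_digraph D"
  shows "\<exists>A. bipartition_class D A \<and> a \<in> A"
proof -
  obtain A B where "A \<inter> B = {}"
    and "\<forall>e\<in>arcs D. tail D e \<in> A \<and> head D e \<in> B \<or> tail D e \<in> B \<and> head D e \<in> A"
    using assms unfolding bipartite_digraph_def by blast
  then have A: "bipartition_class D A"
    by (auto simp: bipartition_class_def arcs_ends_conv)
  then have "bipartition_class D (- A)"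
    by (auto simp: bipartition_class_def)
  with A show ?thesis by (cases "a \<in> A") auto
qed

lemma (in wf_digraph) bipartition_class_awalk:
  assumes "bipartition_class G A"
  shows "awalk u p v \<Longrightarrow> (u \<in> A \<longleftrightarrow> v \<in> A) \<longleftrightarrow> even (length p)"
proof (induction p arbitrary: u)
  case (Cons e p)
  then have "u \<rightarrow>\<^bsub>G\<^esub> head G e" "awalk (head G e) p v"
    by (auto simp: awalk_Cons_iff in_arcs_imp_in_arcs_ends)
  with Cons.IH[of "head G e"] assms show ?case
    by (auto simp: bipartition_class_def)
qed (simp add: awalk_Nil_iff)

lemma (in fin_digraph) cops_win_from_opposite_class:
  assumes stationary: "nearly_dominating G m S" and conn: "strongly_connected G"
    and side: "bipartition_class G A"
    and near: "verts G \<inter> A \<subseteq> dominated G (closed_out_nbhd G a)"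
    and chaser: "c \<in> verts G" and robber: "v \<in> verts G" "v \<notin> A"
  shows "cops_win_from G (c # replicate (m - length S - 1) a @ S) v"
proof (cases "v \<in> dominated G (set S)")
  case True
  then show ?thesis by (intro cops_win_from_dominated) simp
next
  case False
  let ?U = "closed_out_nbhd G v - dominated G (set S) - {v}"
  have "finite ?U"
    using robber(1) by (simp add: finite_closed_out_nbhd)
  moreover have "card ?U \<le> m - length S - 1"
    using stationary robber(1) False finite_closed_out_nbhd[OF robber(1)]
    by (subst card_Diff_singleton) (auto simp: nearly_dominating_def diff_le_mono)
  moreover have "?U \<subseteq> verts G \<inter> A"
    using closed_out_nbhd_subset_verts[OF robber(1)] robber(2) side
    by (auto simp: legal_move_def bipartition_class_def)
  with near have "?U \<subseteq> dominated G (closed_out_nbhd G a)"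
    by blast
  ultimately obtain cs
    where moved: "list_all2 (legal_move G) (replicate (m - length S - 1) a @ S) cs"
    and covered: "?U \<union> dominated G (set S) \<subseteq> dominated G (set cs)"
    by (rule replicate_guards_cover)
  have exits: "cops_win_from G (c' # cs) u" if "v \<rightarrow>\<^bsub>G\<^esub> u" for c' u
  proof (rule cops_win_from_dominated)
    have "u \<noteq> v" "legal_move G v u"
      using that robber(2) side by (auto simp: bipartition_class_def legal_move_def)
    with covered show "u \<in> dominated G (set (c' # cs))" by auto
  qed
  have "c \<rightarrow>\<^sup>*\<^bsub>G\<^esub> v"
    using conn chaser robber(1) by (simp add: strongly_connected_def)
  then have stays: "cops_win_from G (c # cs) v"
    by (rule chaser_wins_or_robber_moves) (rule exits)
  show ?thesis
  proof (rule cops_win_from.move)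
    show "list_all2 (legal_move G) (c # replicate (m - length S - 1) a @ S) (c # cs)"
      using moved by simp
    show "cops_win_from G (c # cs) u" if "legal_move G v u" for u
      using that exits stays by (auto simp: legal_move_def)
  qed
qed

lemma (in fin_digraph) cops_win_if_class_radius_2:
  assumes stationary: "nearly_dominating G m S" and conn: "strongly_connected G"
    and side: "bipartition_class G A" and base: "a \<in> verts G"
    and near: "verts G \<inter> A \<subseteq> dominated G (closed_out_nbhd G a)"
  shows "cops_win G m"
proof -
  let ?cs = "replicate (m - length S - 1) a @ S"
  have opposite: "cops_win_from G (c # ?cs) v" if "c \<in> verts G" "v \<in> verts G" "v \<notin> A" for c v
    using stationary conn side near that by (rule cops_win_from_opposite_class)
  have "cops_win_from G (a # ?cs) v" if robber: "v \<in> verts G" for v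
  proof (cases "v \<in> A")
    case True
    show ?thesis
    proof (rule chaser_wins_or_robber_moves)
      show "a \<rightarrow>\<^sup>*\<^bsub>G\<^esub> v"
        using conn base robber by (simp add: strongly_connected_def)
      show "cops_win_from G (c # ?cs) u" if "c \<in> verts G" "v \<rightarrow>\<^bsub>G\<^esub> u" for c u
        using that opposite True side by (auto simp: bipartition_class_def dest: adj_in_verts)
    qed
  next
    case False
    with base robber show ?thesis by (rule opposite)
  qed
  then have "cops_win G (length (a # ?cs))"
    using stationary base
    by (intro cops_win_if_cops_win_from) (auto simp: nearly_dominating_def)
  with stationary show ?thesis by (simp add: nearly_dominating_def Suc_diff_Suc)
qed

section \<open>Small diameter\<close>

lemma (in wf_digraph) awalk_le_1_imp_legal_move:
  "awalk u p v \<Longrightarrow> length p \<le> 1 \<Longrightarrow> legal_move G u v"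
  by (cases p) (auto simp: legal_move_def awalk_simps dest: in_arcs_imp_in_arcs_ends)

lemma (in wf_digraph) awalk_le_2_imp_mem_dominated:
  assumes "awalk u p v" "length p \<le> 2"
  shows "v \<in> dominated G (closed_out_nbhd G u)"
proof (cases p)
  case Nil
  with assms(1) show ?thesis
    by (auto simp: dominated_def awalk_Nil_iff intro!: bexI[of _ v])
next
  case (Cons e q)
  with assms have "awalk u [e] (head G e)" "awalk (head G e) q v" "length q \<le> 1"
    by (auto simp: awalk_simps)
  then have "legal_move G u (head G e)" "legal_move G (head G e) v"
    by (simp_all add: awalk_le_1_imp_legal_move)
  then show ?thesis
    by (auto simp: dominated_def)
qed

lemma (in wf_digraph) has_diameter_awalk:
  assumes "has_diameter G d" "u \<in> verts G" "v \<in> verts G"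
  obtains p where "awalk u p v" "length p \<le> d"
  using assms unfolding has_diameter_def apath_def by blast

lemma (in wf_digraph) has_diameter_imp_strongly_connected:
  assumes "has_diameter G d" "verts G \<noteq> {}"
  shows "strongly_connected G"
proof (rule strongly_connectedI)
  fix u v assume "u \<in> verts G" "v \<in> verts G"
  with assms(1) obtain p where "awalk u p v"
    by (rule has_diameter_awalk)
  then show "u \<rightarrow>\<^sup>*\<^bsub>G\<^esub> v"
    by (rule reachable_awalkI)
qed fact

lemma (in fin_digraph) cops_win_diameter_2:
  assumes "has_diameter G 2" "a \<in> verts G" "nearly_dominating G m S"
  shows "cops_win G m"
proof -
  have "verts G \<subseteq> dominated G (closed_out_nbhd G a)"
  proof
    fix u assume "u \<in> verts G"
    with assms(1,2) obtain p where "awalk a p u" "length p \<le> 2"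
      by (rule has_diameter_awalk)
    then show "u \<in> dominated G (closed_out_nbhd G a)"
      by (rule awalk_le_2_imp_mem_dominated)
  qed
  with assms(3,2) show ?thesis by (rule cops_win_if_radius_2)
qed

lemma (in fin_digraph) cops_win_bipartite_diameter_3:
  assumes "bipartite_digraph G" "has_diameter G 3" "a \<in> verts G" "nearly_dominating G m S"
  shows "cops_win G m"
proof -
  obtain A where A: "bipartition_class G A" "a \<in> A"
    using bipartite_digraph_imp_bipartition_class[OF assms(1)] by blast
  have "verts G \<inter> A \<subseteq> dominated G (closed_out_nbhd G a)"
  proof
    fix u assume u: "u \<in> verts G \<inter> A"
    then obtain p where p: "awalk a p u" "length p \<le> 3"
      using has_diameter_awalk[OF assms(2,3)] by blast
    have "even (length p)"
      using bipartition_class_awalk[OF A(1) p(1)] A(2) u by simp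
    with p(2) have "length p \<le> 2"
      by (cases "length p = 3") auto
    with p(1) show "u \<in> dominated G (closed_out_nbhd G a)"
      by (rule awalk_le_2_imp_mem_dominated)
  qed
  moreover have "strongly_connected G"
    using assms(2,3) has_diameter_imp_strongly_connected by blast
  ultimately show ?thesis
    using cops_win_if_class_radius_2 assms(3,4) A(1) by simp
qed

lemma (in fin_digraph) cops_win_small_diameter:
  assumes "verts G \<noteq> {}" and "2 * card (verts G) < m * (m + 3)"
    and "has_diameter G 2 \<or> (bipartite_digraph G \<and> has_diameter G 3)"
  shows "cops_win G m"
proof -
  obtain a S where "a \<in> verts G" "nearly_dominating G m S"
    using assms(1) exists_nearly_dominating[OF assms(2)] by blast
  with assms(3) show ?thesis
    using cops_win_diameter_2 cops_win_bipartite_diameter_3 by metis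
qed

theorem theorem12:
  fixes D :: "('a, 'b) pre_digraph" and n :: nat
  assumes "digraph D"
    and "card (verts D) = n"
    and "has_diameter D 2 \<or> (bipartite_digraph D \<and> has_diameter D 3)"
  shows "real (cop_number D) \<le> sqrt (2 * real n)"
proof -
  interpret digraph D by fact
  define m where "m = floor_sqrt (2 * n)"
  have "cops_win D m"
  proof (cases "n = 0")
    case True
    then show ?thesis
      using cops_win_card_verts[of D] assms(2) by (simp add: m_def)
  next
    case False
    then have "verts D \<noteq> {}"
      using assms(2) by auto
    moreover have "2 * n < (Suc m)\<^sup>2" "0 < m"
      using Suc_floor_sqrt_power2_gt False by (simp_all add: m_def)
    then have "2 * card (verts D) < m * (m + 3)"
      using assms(2) by (simp add: power2_eq_square algebra_simps)
    ultimately show ?thesis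
      using assms(3) by (rule cops_win_small_diameter)
  qed
  then have "cop_number D \<le> m"
    unfolding cop_number_def by (rule Least_le)
  then have "(cop_number D)\<^sup>2 \<le> 2 * n"
    by (simp add: m_def le_floor_sqrt_iff)
  then show ?thesis
    by (intro real_le_rsqrt) (simp flip: of_nat_power of_nat_mult)
qed

end
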